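(* Let $n\ge 1$ be an integer. For every subset $M\subseteq [0,n-1]$ and every $i\in[\pm n]$, $$\sum_{\{\sigma\in B_n\,|\,\mathrm{Des}_B(\sigma^{-1})\subseteq M,\ \sigma(n)=i\}} q^{\ell_B(\sigma)}=\sum_{\{\sigma\in B_n\,|\,\mathrm{Des}_B(\sigma^{-1})\subseteq M,\ \sigma(n)=i\}} q^{\mathrm{fmaj}(\sigma)}.$$
   Context: Here $q$ is an indeterminate, $[0,n-1]=\{0,1,\ldots,n-1\}$ and $[\pm n]=\{-n,\ldots,-1,1,\ldots,n\}$. $B_n$ is the hyperoctahedral group: the group (under composition) of all bijections $\sigma$ of $[\pm n]$ with $\sigma(-a)=-\sigma(a)$ for all $a\in[\pm n]$. Write $\sigma=[\sigma(1),\ldots,\sigma(n)]$. $B_n$ is a Coxeter group with generators $s_0=[-1,2,\ldots,n]$ and $s_i=[1,\ldots,i-1,i+1,i,i+2,\ldots,n]$ for $1\le i<n$; $\ell_B(\sigma)$ is the length of $\sigma$, i.e. the minimal $r\in\{0,1,2,\ldots\}$ such that $\sigma=s_{i_1}\cdots s_{i_r}$ for some $i_1,\ldots,i_r\in[0,n-1]$. The $B$-descent set is $\mathrm{Des}_B(\sigma)=\{i\in[0,n-1] : \ell_B(\sigma s_i)<\ell_B(\sigma)\}$ (equivalently, $\{i\in[0,n-1]:\sigma(i)>\sigma(i+1)\}$ with $\sigma(0):=0$). The flag major index is $\mathrm{fmaj}(\sigma)=2\cdot\mathrm{maj}_A(\sigma)+\mathrm{neg}(\sigma)$, where $\mathrm{maj}_A(\sigma)=\sum_{\{1\le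 i\le n-1\,:\,\sigma(i)>\sigma(i+1)\}} i$ (with the usual order $-n<\cdots<-1<1<\cdots<n$) and $\mathrm{neg}(\sigma)=|\{i\in\{1,\ldots,n\}:\sigma(i)<0\}|$. *)

theory Defs
  imports "HOL-Combinatorics.Permutations" "HOL-Computational_Algebra.Polynomial"
begin

definition pm_interval :: "nat \<Rightarrow> int set" where
  "pm_interval n = {- int n..int n} - {0}"

text \<open>
  Since \<^const>\<open>permutes\<close> makes a permutation the identity outside its carrier set, equality of
  signed permutations is equality of functions, the group operation is \<open>\<circ>\<close>,
  and inverses are given by \<^const>\<open>inv\<close>.
\<close>

definition hyperoctahedral :: "nat \<Rightarrow> (int \<Rightarrow> int) set" where
  "hyperoctahedral n =
     {\<sigma>. \<sigma> permutes pm_interval n \<and> (\<forall>a\<in>pm_interval n. \<sigma> (- a) = - \<sigma> a)}"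

text \<open>
  \<open>B_gen 0 = [-1, 2, \<dots>, n]\<close>, and for \<open>1 \<le> i < n\<close> the generator \<open>B_gen i\<close> exchanges
  the entries \<open>i\<close> and \<open>i + 1\<close> of the window \<open>[1, \<dots>, n]\<close>; oddness forces it to exchange
  \<open>-i\<close> and \<open>-(i + 1)\<close> as well.
\<close>

definition B_gen :: "nat \<Rightarrow> int \<Rightarrow> int" where
  "B_gen i =
     (if i = 0 then transpose (- 1) 1
      else transpose (int i) (int i + 1) \<circ> transpose (- int i) (- (int i + 1)))"

text \<open>
  The words considered are lists \<open>[i\<^sub>1, \<dots>, i\<^sub>r]\<close> with entries in \<open>{0..<n}\<close>, evaluated to
  \<open>B_gen i\<^sub>1 \<circ> \<dots> \<circ> B_gen i\<^sub>r\<close>. The value is meaningful for elements of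
  \<^term>\<open>hyperoctahedral n\<close>, which is generated by these elements.
\<close>

definition B_length :: "nat \<Rightarrow> (int \<Rightarrow> int) \<Rightarrow> nat" where
  "B_length n \<sigma> =
     (LEAST r. \<exists>w. length w = r \<and> set w \<subseteq> {0..<n} \<and> \<sigma> = foldr (\<circ>) (map B_gen w) id)"

definition B_Des :: "nat \<Rightarrow> (int \<Rightarrow> int) \<Rightarrow> nat set" where
  "B_Des n \<sigma> = {i\<in>{0..<n}. B_length n (\<sigma> \<circ> B_gen i) < B_length n \<sigma>}"

definition maj_A :: "nat \<Rightarrow> (int \<Rightarrow> int) \<Rightarrow> nat" where
  "maj_A n \<sigma> = (\<Sum>i\<in>{i\<in>{1..<n}. \<sigma> (int i) > \<sigma> (int i + 1)}. i)"

definition neg_count :: "nat \<Rightarrow> (int \<Rightarrow> int) \<Rightarrow> nat" where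
  "neg_count n \<sigma> = card {i\<in>{1..n}. \<sigma> (int i) < 0}"

definition fmaj :: "nat \<Rightarrow> (int \<Rightarrow> int) \<Rightarrow> nat" where
  "fmaj n \<sigma> = 2 * maj_A n \<sigma> + neg_count n \<sigma>"

end

(* A signed permutation with Des_B(inverse) inside M is the same as a word built up one letter at
   a time: values are grouped into signed blocks (M cuts the positive values into blocks, the block
   of 0 being closed under negation), and in every prefix the last letter must be the largest one
   in its block among the letters +-|sigma(1)|, ..., +-|sigma(k)|. With q-factorials taken over the
   blocks as denominator, the sum of q^statistic over all words on a symmetric set B of 2(N+1)
   letters with last letter x is q^(number of letters above x) times (1 - q^2)...(1 - q^(2N))
   for both statistics. Both inductions peel off the last letter and come down to the fact that
   the intervals [#letters above y, #letters above y + size of the block of y) partition [0, 2N). *)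
theory Submission
  imports Defs
begin

section \<open>Length and descents in the hyperoctahedral group\<close>

text \<open>The obstacle is that the two statistics peel differently. A new last letter adds to the
  length an amount depending only on the set of letters so far, but its contribution to the flag
  major index also depends on the previous last letter. Fixing the last letter is what lets the
  second induction close, and that induction needs the partition of [0, 2N) cut off at the new
  letter, not only as a whole. The factor 2 in front of the major index is essential here: a descent
  after k positions weighs q^(2k), and 2k is exactly the number of letters used by these positions,
  so the correction for descents carries the same factor 1 - q^(2k) as the full sum. No quotient is
  ever formed: every identity is multiplied through by the denominator, which is cancelled once,
  when the two statistics are compared.\<close>

lemma hyperoctahedral_odd:
  assumes "\<sigma> \<in> hyperoctahedral n"
  shows "\<sigma> (- a) = - \<sigma> a"
proof (cases "a \<in> pm_interval n")
  case True
  then show ?thesis using assms by (auto simp: hyperoctahedral_def)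
next
  case False
  then have "- a \<notin> pm_interval n" by (auto simp: pm_interval_def)
  then show ?thesis using assms False by (auto simp: hyperoctahedral_def permutes_not_in)
qed

lemma hyperoctahedral_permutes: "\<sigma> \<in> hyperoctahedral n \<Longrightarrow> \<sigma> permutes pm_interval n"
  by (simp add: hyperoctahedral_def)

lemma hyperoctahedral_zero: "\<sigma> \<in> hyperoctahedral n \<Longrightarrow> \<sigma> 0 = 0"
  using hyperoctahedral_odd[of \<sigma> n 0] by simp

lemma hyperoctahedral_not_less_iff:
  assumes "\<sigma> \<in> hyperoctahedral n"
  shows "\<not> \<sigma> a < \<sigma> b \<longleftrightarrow> \<sigma> b < \<sigma> a \<or> a = b"
  unfolding not_less_iff_gr_or_eq inj_eq[OF permutes_inj[OF hyperoctahedral_permutes[OF assms]]] ..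

lemma hyperoctahedral_comp:
  assumes "\<sigma> \<in> hyperoctahedral n" "\<tau> \<in> hyperoctahedral n"
  shows "\<sigma> \<circ> \<tau> \<in> hyperoctahedral n"
  using assms hyperoctahedral_odd[OF assms(1)] permutes_compose[of \<tau> "pm_interval n" \<sigma>]
  by (simp add: hyperoctahedral_def)

lemma hyperoctahedral_id: "id \<in> hyperoctahedral n"
  by (auto simp: hyperoctahedral_def permutes_id)

lemma hyperoctahedral_inv:
  assumes "\<sigma> \<in> hyperoctahedral n"
  shows "inv \<sigma> \<in> hyperoctahedral n"
proof -
  have p: "\<sigma> permutes pm_interval n" using assms by (rule hyperoctahedral_permutes)
  have "inv \<sigma> (- a) = - inv \<sigma> a" for a
    using hyperoctahedral_odd[OF assms, of "inv \<sigma> a"] permutes_inverses[OF p]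
    by (metis (no_types))
  then show ?thesis using permutes_inv[OF p] by (simp add: hyperoctahedral_def)
qed

section \<open>Generators and their effect on inversions\<close>

lemma B_gen_apply:
  "B_gen i x =
     (if i = 0 then if x = 1 then - 1 else if x = - 1 then 1 else x
      else if x = int i then int i + 1 else if x = int i + 1 then int i
      else if x = - int i then - int i - 1 else if x = - int i - 1 then - int i else x)"
  by (auto simp: B_gen_def transpose_def)

lemma B_gen_involution [simp]: "B_gen i (B_gen i x) = x"
  by (auto simp: B_gen_apply)

lemma B_gen_comp_involution [simp]: "\<sigma> \<circ> B_gen i \<circ> B_gen i = \<sigma>"
  by (auto simp: fun_eq_iff)

lemma B_gen_hyperoctahedral:
  assumes "i < n"
  shows "B_gen i \<in> hyperoctahedral n"
proof -
  have "B_gen i permutes pm_interval n"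
  proof (rule bij_imp_permutes)
    show "bij_betw (B_gen i) (pm_interval n) (pm_interval n)"
      by (rule bij_betw_byWitness[of _ "B_gen i"])
        (use assms in \<open>auto simp: B_gen_apply pm_interval_def split: if_splits\<close>)
  next
    fix x assume "x \<notin> pm_interval n"
    then show "B_gen i x = x" using assms by (auto simp: B_gen_apply pm_interval_def)
  qed
  then show ?thesis by (auto simp: hyperoctahedral_def B_gen_apply)
qed

text \<open>
  Inversions of the full window \<open>[\<sigma>(-n), \<dots>, \<sigma>(n)]\<close> come in pairs \<open>(p, r)\<close>, \<open>(-r, -p)\<close>;
  the condition \<open>-r \<le> p\<close> selects one of each pair.
\<close>

definition B_inversions :: "nat \<Rightarrow> (int \<Rightarrow> int) \<Rightarrow> (int \<times> int) set" where
  "B_inversions n \<sigma> = {(p, r). p \<noteq> 0 \<and> - r \<le> p \<and> p < r \<and> r \<le> int n \<and> \<sigma> r < \<sigma> p}"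

lemma finite_B_inversions [simp]: "finite (B_inversions n \<sigma>)"
  by (rule finite_subset[of _ "{- int n..int n} \<times> {- int n..int n}"])
    (auto simp: B_inversions_def)

text \<open>A generator only permutes positions, so carrying pairs of positions along it preserves
  all comparisons of entries. The one pair created is \<open>a\<close>, the pair of exchanged
  positions.\<close>

lemma card_B_inversions_comp_gen:
  assumes \<sigma>: "\<sigma> \<in> hyperoctahedral n" and i: "i < n" and asc: "\<sigma> (int i) < \<sigma> (int i + 1)"
  shows "card (B_inversions n (\<sigma> \<circ> B_gen i)) = Suc (card (B_inversions n \<sigma>))"
proof -
  define a where "a = (if i = 0 then (- 1, 1) else (int i, int i + 1))"
  \<comment> \<open>The pair \<open>(- i, i + 1)\<close> would be carried to
    \<open>(- i - 1, i)\<close>, its own mirror image, which is not the selected representative. It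
    is therefore kept fixed; the second element of \<open>E\<close> makes \<open>f\<close> an
    involution.\<close>
  define E where "E = (if i = 0 then {} else {(- int i, int i + 1), (- int i - 1, int i)})"
  define f where "f = (\<lambda>(p, r). if (p, r) \<in> E then (p, r) else (B_gen i p, B_gen i r))"
  note odd = hyperoctahedral_odd[OF \<sigma>]
  have s0: "\<sigma> 0 = 0" using \<sigma> by (rule hyperoctahedral_zero)
  have swap_E: "(B_gen i p, B_gen i r) \<in> E" if "(p, r) \<in> E" for p r
    using that by (auto simp: E_def B_gen_apply split: if_splits)
  have ff: "f (f x) = x" for x
  proof (cases x)
    case (Pair p r)
    then show ?thesis using swap_E[of "B_gen i p" "B_gen i r"] by (auto simp: f_def)
  qed
  have anot: "a \<notin> B_inversions n \<sigma>"
    using asc odd[of 1] s0 by (auto simp: a_def B_inversions_def)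
  have ain: "a \<in> B_inversions n (\<sigma> \<circ> B_gen i)"
    using asc odd[of 1] s0 i by (auto simp: a_def B_inversions_def B_gen_apply)
  have odd_i: "\<sigma> (- int i) = - \<sigma> (int i)" "\<sigma> (- int i - 1) = - \<sigma> (int i + 1)"
    using odd[of "int i"] odd[of "int i + 1"] by (simp_all only: minus_add_distrib diff_conv_add_uminus)
  \<comment> \<open>Kept general in \<open>\<tau>\<close>: it serves once for
    \<open>\<sigma>\<close> and once, on the way back, for
    \<open>\<sigma> \<circ> B_gen i\<close>.\<close>
  have key: "f x \<in> B_inversions n \<tau>'"
    if "x \<in> B_inversions n \<tau>" "x \<noteq> a" and "\<tau>' = \<tau> \<circ> B_gen i"
      and odd_i: "\<tau> (- int i) = - \<tau> (int i)" "\<tau> (- int i - 1) = - \<tau> (int i + 1)" for x \<tau> \<tau>'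
  proof -
    obtain p r where x: "x = (p, r)" by fastforce
    have pr: "p \<noteq> 0" "- r \<le> p" "p < r" "r \<le> int n" "\<tau> r < \<tau> p"
      using that x by (auto simp: B_inversions_def)
    show ?thesis
    proof (cases "(p, r) \<in> E")
      case True
      then have "i \<noteq> 0" "p = - int i" "r = int i + 1" using pr by (auto simp: E_def split: if_splits)
      then show ?thesis using True pr x odd_i that(3)
        by (simp add: B_inversions_def f_def B_gen_apply)
    next
      case False
      have "B_gen i p \<noteq> 0" using pr(1) by (auto simp: B_gen_apply)
      moreover have "B_gen i p < B_gen i r"
        using pr(1-4) False \<open>x \<noteq> a\<close> x unfolding B_gen_apply a_def E_def by (auto split: if_splits)
      moreover have "- B_gen i r \<le> B_gen i p"
        using pr(1-4) False x unfolding B_gen_apply E_def by (auto split: if_splits)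
      moreover have "B_gen i r \<le> int n"
        using pr(1-4) i unfolding B_gen_apply by (auto split: if_splits)
      ultimately show ?thesis using False pr(5) x that(3) by (simp add: f_def B_inversions_def)
    qed
  qed
  have "f ` B_inversions n \<sigma> = B_inversions n (\<sigma> \<circ> B_gen i) - {a}"
  proof (intro equalityI subsetI)
    fix y assume "y \<in> f ` B_inversions n \<sigma>"
    then obtain x where x: "x \<in> B_inversions n \<sigma>" "y = f x" by blast
    have "x \<noteq> a" using x anot by blast
    have "f x \<in> B_inversions n (\<sigma> \<circ> B_gen i)"
      by (rule key[OF x(1) \<open>x \<noteq> a\<close> refl odd_i])
    moreover have "f x \<noteq> a"
    proof
      assume "f x = a"
      then have "x = f a" using ff by metis
      also have "f a = prod.swap a" by (auto simp: a_def f_def E_def B_gen_apply)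
      finally show False using x(1) by (auto simp: a_def B_inversions_def split: if_splits)
    qed
    ultimately show "y \<in> B_inversions n (\<sigma> \<circ> B_gen i) - {a}" using x by simp
  next
    fix y assume y: "y \<in> B_inversions n (\<sigma> \<circ> B_gen i) - {a}"
    have "f y \<in> B_inversions n \<sigma>"
      by (rule key[of y "\<sigma> \<circ> B_gen i"]) (use y odd_i odd[of 1] s0 in \<open>auto simp: B_gen_apply\<close>)
    then show "y \<in> f ` B_inversions n \<sigma>" using ff[of y] by (metis imageI)
  qed
  moreover have "inj_on f (B_inversions n \<sigma>)" by (metis ff inj_onI)
  ultimately have "card (B_inversions n \<sigma>) = card (B_inversions n (\<sigma> \<circ> B_gen i) - {a})"
    by (metis card_image)
  then show ?thesis using ain by (metis card.remove finite_B_inversions)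
qed

lemma card_B_inversions_comp_gen_desc:
  assumes "\<sigma> \<in> hyperoctahedral n" and i: "i < n" and "\<sigma> (int i + 1) < \<sigma> (int i)"
  shows "Suc (card (B_inversions n (\<sigma> \<circ> B_gen i))) = card (B_inversions n \<sigma>)"
proof -
  let ?\<tau> = "\<sigma> \<circ> B_gen i"
  have \<tau>: "?\<tau> \<in> hyperoctahedral n"
    using assms by (simp add: hyperoctahedral_comp B_gen_hyperoctahedral)
  have "?\<tau> (int i) < ?\<tau> (int i + 1)"
    using assms hyperoctahedral_odd[OF assms(1), of 1] hyperoctahedral_zero[OF assms(1)]
    by (auto simp: B_gen_apply)
  from card_B_inversions_comp_gen[OF \<tau> i this]
  show ?thesis by (simp only: B_gen_comp_involution)
qed

text \<open>The chain 0 < \<sigma>(1) < ... < \<sigma>(n) \<le> n leaves no room: climbing from 0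
  bounds \<sigma>(k) below by k, descending from n bounds it above by k.\<close>

lemma hyperoctahedral_ascending_eq_id:
  assumes \<sigma>: "\<sigma> \<in> hyperoctahedral n" and asc: "\<And>i. i < n \<Longrightarrow> \<sigma> (int i) < \<sigma> (int i + 1)"
  shows "\<sigma> = id"
proof -
  have lower: "int k \<le> \<sigma> (int k)" if "k \<le> n" for k
    using that
  proof (induction k)
    case 0
    then show ?case using hyperoctahedral_zero[OF \<sigma>] by simp
  next
    case (Suc k)
    then show ?case using asc[of k] by (simp add: add.commute)
  qed
  have upper: "\<sigma> (int (n - k)) \<le> int (n - k)" if "k < n" for k
    using that
  proof (induction k)
    case 0
    then have "int n \<in> pm_interval n" by (simp add: pm_interval_def)
    then have "\<sigma> (int n) \<in> pm_interval n"
      using hyperoctahedral_permutes[OF \<sigma>] by (metis permutes_in_image)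
    then show ?case by (simp add: pm_interval_def)
  next
    case (Suc k)
    then have "n - k = Suc (n - Suc k)" by simp
    then show ?case using Suc asc[of "n - Suc k"] by (simp add: add.commute)
  qed
  have pos: "\<sigma> (int k) = int k" if "1 \<le> k" "k \<le> n" for k
    using lower[of k] upper[of "n - k"] that by simp
  show ?thesis
  proof
    fix x
    consider "x \<notin> pm_interval n" | "1 \<le> x" "x \<le> int n" | "1 \<le> - x" "- x \<le> int n"
      by (force simp: pm_interval_def)
    then show "\<sigma> x = id x"
    proof cases
      case 1
      then show ?thesis using hyperoctahedral_permutes[OF \<sigma>] by (simp add: permutes_not_in)
    next
      case 2
      then show ?thesis using pos[of "nat x"] by simp
    next
      case 3
      then show ?thesis using pos[of "nat (- x)"] hyperoctahedral_odd[OF \<sigma>, of x] by simp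
    qed
  qed
qed

section \<open>Length as the number of inversions\<close>

lemma foldr_comp_snoc:
  "foldr (\<circ>) (map B_gen (w @ [i])) id = foldr (\<circ>) (map B_gen w) id \<circ> B_gen i"
  by (induction w) (auto simp: o_assoc)

text \<open>This is sorting: at a descent \<open>i\<close>, multiplying by \<open>B_gen i\<close>
  removes exactly one inversion, and without descents only the identity is left.\<close>

lemma B_word_exists:
  assumes "\<sigma> \<in> hyperoctahedral n"
  shows "\<exists>w. length w = card (B_inversions n \<sigma>) \<and> set w \<subseteq> {0..<n} \<and>
             \<sigma> = foldr (\<circ>) (map B_gen w) id"
  using assms
proof (induction "card (B_inversions n \<sigma>)" arbitrary: \<sigma>)
  case 0
  have "\<sigma> (int i) < \<sigma> (int i + 1)" if "i < n" for i
    using card_B_inversions_comp_gen_desc[OF 0(2) that] 0(1) hyperoctahedral_not_less_iff[OF 0(2)]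
    by fastforce
  then have "\<sigma> = id" by (rule hyperoctahedral_ascending_eq_id[OF 0(2)])
  then show ?case using 0 by (intro exI[of _ "[]"]) simp
next
  case (Suc k)
  have "\<sigma> \<noteq> id"
  proof
    assume "\<sigma> = id"
    then have "B_inversions n \<sigma> = {}" by (auto simp: B_inversions_def)
    then show False using Suc.hyps(2) by simp
  qed
  then obtain i where i: "i < n" "\<not> \<sigma> (int i) < \<sigma> (int i + 1)"
    using hyperoctahedral_ascending_eq_id[OF Suc.prems] by blast
  then have "\<sigma> (int i + 1) < \<sigma> (int i)"
    using hyperoctahedral_not_less_iff[OF Suc.prems] by fastforce
  from card_B_inversions_comp_gen_desc[OF Suc.prems i(1) this] Suc.hyps(2)
  have k: "k = card (B_inversions n (\<sigma> \<circ> B_gen i))" by simp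
  from Suc.hyps(1)[OF this hyperoctahedral_comp[OF Suc.prems B_gen_hyperoctahedral[OF i(1)]]] k
  obtain w where w: "length w = k" "set w \<subseteq> {0..<n}"
      "\<sigma> \<circ> B_gen i = foldr (\<circ>) (map B_gen w) id"
    by auto
  have "\<sigma> = foldr (\<circ>) (map B_gen (w @ [i])) id"
    unfolding foldr_comp_snoc w(3)[symmetric] by simp
  then show ?case using w i(1) Suc.hyps(2) by (intro exI[of _ "w @ [i]"]) simp
qed

text \<open>Each further generator changes the number of inversions by exactly one, so no shorter
  word can exist.\<close>

lemma B_word_length_ge:
  assumes "set w \<subseteq> {0..<n}"
  shows "foldr (\<circ>) (map B_gen w) id \<in> hyperoctahedral n \<and>
         card (B_inversions n (foldr (\<circ>) (map B_gen w) id)) \<le> length w"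
  using assms
proof (induction w rule: rev_induct)
  case Nil
  have "B_inversions n id = {}" by (auto simp: B_inversions_def)
  then show ?case using hyperoctahedral_id by (simp add: id_def)
next
  case (snoc i w)
  let ?\<sigma> = "foldr (\<circ>) (map B_gen w) id"
  have i: "i < n" and "set w \<subseteq> {0..<n}" using snoc.prems by auto
  with snoc.IH have \<sigma>: "?\<sigma> \<in> hyperoctahedral n" and le: "card (B_inversions n ?\<sigma>) \<le> length w"
    by blast+
  have "card (B_inversions n (?\<sigma> \<circ> B_gen i)) \<le> Suc (card (B_inversions n ?\<sigma>))"
  proof (cases "?\<sigma> (int i) < ?\<sigma> (int i + 1)")
    case True
    then show ?thesis using card_B_inversions_comp_gen[OF \<sigma> i] by simp
  next
    case False
    then have "?\<sigma> (int i + 1) < ?\<sigma> (int i)" using hyperoctahedral_not_less_iff[OF \<sigma>] by fastforce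
    then show ?thesis using card_B_inversions_comp_gen_desc[OF \<sigma> i] by simp
  qed
  also have "\<dots> \<le> length (w @ [i])" using le by simp
  finally show ?case
    unfolding foldr_comp_snoc
    using hyperoctahedral_comp[OF \<sigma> B_gen_hyperoctahedral[OF i]] by blast
qed

theorem B_length_eq_card_inversions:
  assumes "\<sigma> \<in> hyperoctahedral n"
  shows "B_length n \<sigma> = card (B_inversions n \<sigma>)"
  unfolding B_length_def
  using B_word_exists[OF assms] B_word_length_ge by (intro Least_equality) auto

lemma B_Des_iff:
  assumes "\<sigma> \<in> hyperoctahedral n"
  shows "i \<in> B_Des n \<sigma> \<longleftrightarrow> i < n \<and> \<sigma> (int i + 1) < \<sigma> (int i)"
proof (cases "i < n")
  case True
  have "B_length n (\<sigma> \<circ> B_gen i) < B_length n \<sigma> \<longleftrightarrow> \<sigma> (int i + 1) < \<sigma> (int i)"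
    using B_length_eq_card_inversions[OF assms]
      B_length_eq_card_inversions[OF hyperoctahedral_comp[OF assms B_gen_hyperoctahedral[OF True]]]
      card_B_inversions_comp_gen[OF assms True]
      card_B_inversions_comp_gen_desc[OF assms True]
      hyperoctahedral_not_less_iff[OF assms, of "int i" "int i + 1"]
    by (cases "\<sigma> (int i) < \<sigma> (int i + 1)") auto
  then show ?thesis using True by (simp add: B_Des_def)
qed (simp add: B_Des_def)

section \<open>Words on a symmetric alphabet\<close>

abbreviation qpow :: "nat \<Rightarrow> int poly" where
  "qpow k \<equiv> monom 1 k"

definition letters :: "int list \<Rightarrow> int set" where
  "letters w = set w \<union> uminus ` set w"

text \<open>
  A word lists a window from right to left, so that its head is the last entry
  \<open>\<sigma>(n)\<close>. Both statistics are split into the contributions of the successive heads.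
\<close>

primrec word_length :: "int list \<Rightarrow> nat" where
  "word_length [] = 0"
| "word_length (y # w) = word_length w + card {z \<in> letters (y # w). y < z}"

primrec word_fmaj :: "int list \<Rightarrow> nat" where
  "word_fmaj [] = 0"
| "word_fmaj (y # w) = word_fmaj w + (if y < 0 then 1 else 0)
     + (if w \<noteq> [] \<and> y < hd w then 2 * length w else 0)"

definition symmetric_set :: "int set \<Rightarrow> bool" where
  "symmetric_set B \<longleftrightarrow> finite B \<and> 0 \<notin> B \<and> (\<forall>z\<in>B. - z \<in> B)"

definition above :: "int set \<Rightarrow> int \<Rightarrow> nat" where
  "above B y = card {z \<in> B. y < z}"

lemma letters_Nil [simp]: "letters [] = {}"
  by (simp add: letters_def)

lemma letters_Cons: "letters (y # w) = insert y (insert (- y) (letters w))"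
  by (auto simp: letters_def)

lemma uminus_mem_letters: "- z \<in> letters w \<longleftrightarrow> z \<in> letters w"
  by (force simp: letters_def)

lemma finite_letters [simp]: "finite (letters w)"
  by (simp add: letters_def)

lemma symmetric_set_remove: "symmetric_set B \<Longrightarrow> symmetric_set (B - {y, - y})"
  by (auto simp: symmetric_set_def)

lemma card_symmetric_set:
  assumes "symmetric_set B"
  shows "card B = 2 * card {z \<in> B. 0 < z}"
proof -
  have "B = {z \<in> B. 0 < z} \<union> uminus ` {z \<in> B. 0 < z}"
  proof (intro equalityI subsetI)
    fix z assume z: "z \<in> B"
    then have "z \<noteq> 0" "- z \<in> B" using assms by (auto simp: symmetric_set_def)
    then show "z \<in> {z \<in> B. 0 < z} \<union> uminus ` {z \<in> B. 0 < z}"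
      using z by (cases "0 < z") (auto intro: image_eqI[of _ _ "- z"])
  qed (use assms in \<open>auto simp: symmetric_set_def\<close>)
  then have "card B = card ({z \<in> B. 0 < z} \<union> uminus ` {z \<in> B. 0 < z})" by simp
  also have "\<dots> = card {z \<in> B. 0 < z} + card (uminus ` {z \<in> B. 0 < z})"
    by (rule card_Un_disjoint) (use assms in \<open>auto simp: symmetric_set_def\<close>)
  finally show ?thesis by (simp add: card_image)
qed

lemma card_symmetric_set_remove:
  assumes "symmetric_set B" "y \<in> B"
  shows "card B = Suc (Suc (card (B - {y, - y})))"
proof -
  have sub: "{y, - y} \<subseteq> B" and "y \<noteq> - y" and fin: "finite B"
    using assms by (auto simp: symmetric_set_def)
  then have "card {y, - y} = 2" by simp
  then show ?thesis
    using card_Diff_subset[OF _ sub] card_mono[OF fin sub] by simp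
qed

lemma qpow_neq_one:
  assumes "0 < k"
  shows "qpow k \<noteq> 1"
proof
  assume "qpow k = 1"
  then have "coeff (qpow k) 0 = coeff 1 0" by simp
  then show False using assms by simp
qed

section \<open>Signed blocks, their maxima and the telescoping sum\<close>

lemma sum_telescope_int:
  fixes h :: "int \<Rightarrow> 'a :: ab_group_add"
  shows "(\<Sum>v\<in>{w<..w + int k}. h v - h (v - 1)) = h (w + int k) - h w"
proof (induction k)
  case (Suc k)
  have "{w<..w + int (Suc k)} = insert (w + int k + 1) {w<..w + int k}" by auto
  then show ?case using Suc by (simp add: algebra_simps)
qed simp

text \<open>Here \<open>s z\<close> is the label of the block of \<open>z\<close>. Monotonicity
  makes blocks intervals, so letters of different blocks compare as their labels do; oddness makes
  negation carry block \<open>v\<close> to block \<open>- v\<close>.\<close>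

locale signed_blocks =
  fixes s :: "int \<Rightarrow> int"
  assumes mono: "mono s" and odd: "s (- z) = - s z"
begin

definition tops :: "int set \<Rightarrow> int set" where
  "tops B = {y \<in> B. \<forall>z\<in>B. s z = s y \<longrightarrow> z \<le> y}"

primrec admissible :: "int list \<Rightarrow> bool" where
  "admissible [] \<longleftrightarrow> True"
| "admissible (y # w) \<longleftrightarrow>
     admissible w \<and> y \<noteq> 0 \<and> y \<notin> letters w \<and> y \<in> tops (letters (y # w))"

definition words :: "int set \<Rightarrow> int list set" where
  "words B = {w. admissible w \<and> letters w = B}"

definition fibre :: "int set \<Rightarrow> int \<Rightarrow> nat" where
  "fibre B v = card {z \<in> B. s z = v}"

definition height :: "int set \<Rightarrow> int \<Rightarrow> nat" where
  "height B v = card {z \<in> B. v < s z}"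

lemma less_if_s_less: "s y < s z \<Longrightarrow> y < z"
  using mono by (metis monoD not_le)

lemma tops_less_iff:
  assumes "x \<in> tops B" "z \<in> B"
  shows "x < z \<longleftrightarrow> s x < s z"
proof
  assume "x < z"
  then have "s x \<le> s z" using mono by (simp add: monoD)
  moreover have "s z \<noteq> s x" using assms \<open>x < z\<close> by (auto simp: tops_def)
  ultimately show "s x < s z" by simp
qed (rule less_if_s_less)

text \<open>No letter above a block maximum shares its block, so the count depends on the label
  alone; this turns sums over letters into sums over labels.\<close>

lemma above_tops: "y \<in> tops B \<Longrightarrow> above B y = height B (s y)"
  unfolding above_def height_def by (metis (lifting) tops_less_iff)

lemma inj_on_tops: "inj_on s (tops B)"
  by (rule inj_onI) (auto simp: tops_def intro: antisym)

lemma image_tops: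
  assumes "finite B"
  shows "s ` tops B = s ` B"
proof (intro equalityI subsetI)
  fix v assume "v \<in> s ` B"
  then have ne: "{z \<in> B. s z = v} \<noteq> {}" and fin: "finite {z \<in> B. s z = v}" using assms by auto
  let ?y = "Max {z \<in> B. s z = v}"
  have "?y \<in> {z \<in> B. s z = v}" using Max_in[OF fin ne] .
  moreover have "z \<le> ?y" if "z \<in> B" "s z = v" for z using that fin by simp
  ultimately have "?y \<in> tops B" "s ?y = v" by (auto simp: tops_def)
  then show "v \<in> s ` tops B" by (metis imageI)
qed (auto simp: tops_def)

lemma height_pred:
  assumes "finite B"
  shows "height B (v - 1) = height B v + fibre B v"
proof -
  have "{z \<in> B. v - 1 < s z} = {z \<in> B. v < s z} \<union> {z \<in> B. s z = v}" by auto
  then show ?thesis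
    unfolding height_def fibre_def using assms by (simp add: card_Un_disjoint disjoint_iff)
qed

text \<open>The size of block \<open>v\<close> is the increment of \<open>height\<close> from
  \<open>v\<close> to \<open>v - 1\<close>, so each summand is a difference of consecutive powers.
  The cut-off \<open>w\<close> serves the flag major index, where the letters above the last one
  carry an extra weight.\<close>

lemma sum_tops_above:
  assumes fin: "finite B"
  shows "(\<Sum>y\<in>{y \<in> tops B. w < s y}. qpow (above B y) * (1 - qpow (fibre B (s y)))) =
         1 - qpow (height B w)"
proof -
  let ?h = "\<lambda>v. qpow (height B v)"
  obtain K where K: "\<And>z. z \<in> B \<Longrightarrow> s z \<le> K"
    using bdd_above_finite[of "s ` B"] fin by (auto simp: bdd_above_def)
  define k where "k = nat (K - w)"
  have "\<not> w + int k < s z" if "z \<in> B" for z using K[OF that] by (simp add: k_def)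
  then have "{z \<in> B. w + int k < s z} = {}" by blast
  then have "height B (w + int k) = 0" by (simp only: height_def card.empty)
  then have top: "?h (w + int k) = 1" by simp
  have step: "qpow (height B v) * (1 - qpow (fibre B v)) = ?h v - ?h (v - 1)" for v
    by (simp add: height_pred[OF fin] mult_monom algebra_simps)
  have "(\<Sum>y\<in>{y \<in> tops B. w < s y}. qpow (above B y) * (1 - qpow (fibre B (s y)))) =
        (\<Sum>y\<in>{y \<in> tops B. w < s y}. ?h (s y) - ?h (s y - 1))"
    by (rule sum.cong) (auto simp: above_tops step)
  also have "\<dots> = (\<Sum>v\<in>s ` {y \<in> tops B. w < s y}. ?h v - ?h (v - 1))"
    by (subst sum.reindex) (auto intro: inj_on_subset[OF inj_on_tops])
  also have "s ` {y \<in> tops B. w < s y} = {v \<in> s ` B. w < v}"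
    unfolding image_tops[OF fin, symmetric] by auto
  \<comment> \<open>Labels without letters add zero because the height does not change there, so the
    sum may run over a whole interval of integers. Its upper end is at least every label, hence has
    height 0.\<close>
  also have "(\<Sum>v\<in>{v \<in> s ` B. w < v}. ?h v - ?h (v - 1)) =
             (\<Sum>v\<in>{w<..w + int k}. ?h v - ?h (v - 1))"
  proof (rule sum.mono_neutral_left)
    show "{v \<in> s ` B. w < v} \<subseteq> {w<..w + int k}" using K by (force simp: k_def)
    show "\<forall>v\<in>{w<..w + int k} - {v \<in> s ` B. w < v}. ?h v - ?h (v - 1) = 0"
    proof
      fix v assume "v \<in> {w<..w + int k} - {v \<in> s ` B. w < v}"
      then have "{z \<in> B. s z = v} = {}" by auto
      then have "fibre B v = 0" unfolding fibre_def by (simp only: card.empty)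
      then show "?h v - ?h (v - 1) = 0" by (simp add: height_pred[OF fin])
    qed
  qed simp
  also have "\<dots> = 1 - ?h w" by (simp add: sum_telescope_int[where h = ?h] top)
  finally show ?thesis .
qed

lemma sum_tops:
  assumes fin: "finite B"
  shows "(\<Sum>y\<in>tops B. qpow (above B y) * (1 - qpow (fibre B (s y)))) = 1 - qpow (card B)"
proof -
  obtain w where w: "\<And>z. z \<in> B \<Longrightarrow> w \<le> s z"
    using bdd_below_finite[of "s ` B"] fin by (auto simp: bdd_below_def)
  then have w': "w - 1 < s z" if "z \<in> B" for z using that by fastforce
  have "{y \<in> tops B. w - 1 < s y} = tops B" "{z \<in> B. w - 1 < s z} = B"
    using w' by (auto simp: tops_def)
  then show ?thesis using sum_tops_above[OF fin, of "w - 1"] by (simp only: height_def)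
qed

section \<open>Peeling off the last letter of an admissible word\<close>

lemma length_word:
  assumes "admissible w"
  shows "symmetric_set (letters w) \<and> card (letters w) = 2 * length w"
  using assms
proof (induction w)
  case Nil
  then show ?case by (simp add: symmetric_set_def)
next
  case (Cons y w)
  then show ?case
    by (auto simp: letters_Cons symmetric_set_def uminus_mem_letters)
qed

lemma finite_words: "finite (words B)"
proof (cases "finite B")
  case True
  have "words B \<subseteq> {w. set w \<subseteq> B \<and> length w = card B div 2}"
    using length_word by (auto simp: words_def letters_def)
  then show ?thesis using finite_lists_length_eq[OF True] by (rule finite_subset)
next
  case False
  then have "words B = {}" using finite_letters by (auto simp: words_def)
  then show ?thesis by simp
qed

lemma words_empty: "words {} = {[]}"
proof -
  have "w = []" if "letters w = {}" for w using that by (cases w) (auto simp: letters_Cons)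
  then show ?thesis by (auto simp: words_def)
qed

lemma Cons_mem_words_iff:
  assumes "symmetric_set B"
  shows "y # w \<in> words B \<longleftrightarrow> y \<in> tops B \<and> w \<in> words (B - {y, - y})"
proof
  assume *: "y # w \<in> words B"
  then have "letters w = B - {y, - y}"
    using uminus_mem_letters[of y w] by (auto simp: words_def letters_Cons)
  then show "y \<in> tops B \<and> w \<in> words (B - {y, - y})" using * by (auto simp: words_def)
next
  assume *: "y \<in> tops B \<and> w \<in> words (B - {y, - y})"
  then have "y \<in> B" by (auto simp: tops_def)
  then have "- y \<in> B" "y \<noteq> 0" using assms by (auto simp: symmetric_set_def)
  then have "letters (y # w) = B" using * \<open>y \<in> B\<close> by (auto simp: words_def letters_Cons)
  then show "y # w \<in> words B" using * \<open>y \<noteq> 0\<close> by (auto simp: words_def)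
qed

lemma words_head_eq:
  assumes "symmetric_set B" "B \<noteq> {}"
  shows "{w \<in> words B. hd w = x} = (if x \<in> tops B then Cons x ` words (B - {x, - x}) else {})"
proof (intro set_eqI)
  fix w
  have "[] \<notin> words B" using assms(2) by (simp add: words_def)
  then show "w \<in> {w \<in> words B. hd w = x} \<longleftrightarrow>
      w \<in> (if x \<in> tops B then Cons x ` words (B - {x, - x}) else {})"
    using Cons_mem_words_iff[OF assms(1)] by (cases w) auto
qed

definition head_sum :: "(int list \<Rightarrow> nat) \<Rightarrow> int set \<Rightarrow> int \<Rightarrow> int poly" where
  "head_sum f B x = (\<Sum>w\<in>words (B - {x, - x}). qpow (f (x # w)))"

lemma sum_words:
  assumes B: "symmetric_set B" "B \<noteq> {}"
  shows "(\<Sum>w\<in>words B. g w) = (\<Sum>y\<in>tops B. \<Sum>w\<in>words (B - {y, - y}). g (y # w))"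
proof -
  have fin: "finite (tops B)" using B by (auto simp: tops_def symmetric_set_def)
  have "words B = (\<Union>y\<in>tops B. Cons y ` words (B - {y, - y}))"
  proof (intro set_eqI)
    fix w show "w \<in> words B \<longleftrightarrow> w \<in> (\<Union>y\<in>tops B. Cons y ` words (B - {y, - y}))"
      using B by (cases w) (auto simp: Cons_mem_words_iff, auto simp: words_def)
  qed
  then have "(\<Sum>w\<in>words B. g w) = (\<Sum>w\<in>(\<Union>y\<in>tops B. Cons y ` words (B - {y, - y})). g w)"
    by simp
  also have "\<dots> = (\<Sum>y\<in>tops B. \<Sum>w\<in>Cons y ` words (B - {y, - y}). g w)"
    by (rule sum.UNION_disjoint) (use fin finite_words in auto)
  also have "\<dots> = (\<Sum>y\<in>tops B. \<Sum>w\<in>words (B - {y, - y}). g (y # w))"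
    by (rule sum.cong[OF refl]) (simp add: sum.reindex[unfolded o_def])
  finally show ?thesis .
qed

section \<open>Product formula for words with a given last letter\<close>

definition numer :: "nat \<Rightarrow> int poly" where
  "numer N = (\<Prod>j\<in>{1..N}. 1 - qpow (2 * j))"

text \<open>Up to powers of 1 - q this is the Poincare polynomial of a parabolic subgroup: type B
  for block 0, which consists of pairs \<open>z\<close>, \<open>- z\<close>, and type A for each
  positive label; \<open>numer N\<close> is the one of type B and rank N. Empty blocks give empty
  products, so one bound \<open>K\<close> can stay fixed while letters are removed.\<close>

definition denom :: "int \<Rightarrow> int set \<Rightarrow> int poly" where
  "denom K B = (\<Prod>j\<in>{1..fibre B 0 div 2}. 1 - qpow (2 * j)) *
               (\<Prod>v\<in>{1..K}. \<Prod>j\<in>{1..fibre B v}. 1 - qpow j)"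

lemma denom_nonzero: "denom K B \<noteq> 0"
  by (simp add: denom_def qpow_neq_one)

lemma fibre_uminus:
  assumes "symmetric_set B"
  shows "fibre B (- v) = fibre B v"
proof -
  have "bij_betw uminus {z \<in> B. s z = - v} {z \<in> B. s z = v}"
    by (rule bij_betw_byWitness[of _ uminus])
      (use assms odd in \<open>auto simp: symmetric_set_def\<close>)
  then show ?thesis unfolding fibre_def by (rule bij_betw_same_card)
qed

lemma fibre_remove_other:
  assumes "v \<noteq> s y" "v \<noteq> - s y"
  shows "fibre (B - {y, - y}) v = fibre B v"
proof -
  have "{z \<in> B - {y, - y}. s z = v} = {z \<in> B. s z = v}" using assms odd by auto
  then show ?thesis by (simp add: fibre_def)
qed

lemma fibre_remove_zero:
  assumes B: "symmetric_set B" and y: "y \<in> B" "s y = 0"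
  shows "fibre B 0 = 2 * Suc (fibre (B - {y, - y}) 0 div 2)"
proof -
  have S: "symmetric_set {z \<in> B. s z = 0}" using B odd by (auto simp: symmetric_set_def)
  have eq: "{z \<in> B - {y, - y}. s z = 0} = {z \<in> B. s z = 0} - {y, - y}" by auto
  have "fibre B 0 = Suc (Suc (fibre (B - {y, - y}) 0))"
    unfolding fibre_def eq by (rule card_symmetric_set_remove[OF S]) (simp add: y)
  moreover have "even (fibre B 0)"
    unfolding fibre_def using card_symmetric_set[OF S] by (metis dvd_triv_left)
  moreover have "a = 2 * Suc (b div 2)" if "a = Suc (Suc b)" "even a" for a b :: nat
    using that by presburger
  ultimately show ?thesis by blast
qed

lemma fibre_remove_nonzero:
  assumes B: "symmetric_set B" and y: "y \<in> B" "s y \<noteq> 0"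
  shows "fibre B (s y) = Suc (fibre (B - {y, - y}) (s y))"
proof -
  have "{z \<in> B - {y, - y}. s z = s y} = {z \<in> B. s z = s y} - {y}" using y odd by auto
  moreover have "finite {z \<in> B. s z = s y}" using B by (simp add: symmetric_set_def)
  ultimately show ?thesis
    unfolding fibre_def using y by (simp add: card.remove[of _ y] del: card_Diff_insert)
qed

text \<open>Block 0 shrinks from 2k to 2k - 2 letters and drops the type B factor 1 - q^(2k); any
  other block of label |s y| loses exactly one of \<open>y\<close>, \<open>- y\<close> and drops its
  last type A factor. Either way the exponent is the size of the block of \<open>y\<close>, as in
  the telescoping sum.\<close>

lemma denom_remove:
  assumes B: "symmetric_set B" and y: "y \<in> B" and K: "\<forall>z\<in>B. s z \<le> K"
  shows "denom K B = denom K (B - {y, - y}) * (1 - qpow (fibre B (s y)))"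
proof (cases "s y = 0")
  case True
  let ?k = "fibre (B - {y, - y}) 0 div 2"
  have "(\<Prod>v\<in>{1..K}. \<Prod>j\<in>{1..fibre (B - {y, - y}) v}. 1 - qpow j) =
        (\<Prod>v\<in>{1..K}. \<Prod>j\<in>{1..fibre B v}. 1 - qpow j)"
    by (rule prod.cong) (use True in \<open>auto simp: fibre_remove_other\<close>)
  moreover have "(\<Prod>j\<in>{1..fibre B 0 div 2}. 1 - qpow (2 * j)) =
      (\<Prod>j\<in>{1..?k}. 1 - qpow (2 * j)) * (1 - qpow (fibre B 0))"
    using fibre_remove_zero[OF B y True] by (simp add: mult.commute)
  ultimately show ?thesis by (simp only: denom_def True ac_simps)
next
  case False
  define u where "u = \<bar>s y\<bar>"
  have u: "u \<in> {1..K}"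
    using False bspec[OF K y] bspec[OF K, of "- y"] y odd[of y] B
    by (auto simp: u_def symmetric_set_def abs_if)
  have fu: "fibre B u = fibre B (s y)"
    using fibre_uminus[OF B, of "s y"] by (simp add: u_def abs_if)
  have fu': "fibre (B - {y, - y}) u = fibre (B - {y, - y}) (s y)"
    using fibre_uminus[OF symmetric_set_remove[OF B], of y "s y"] by (simp add: u_def abs_if)
  let ?P = "\<lambda>B v. \<Prod>j\<in>{1..fibre B v}. 1 - qpow j"
  have "?P B u = ?P (B - {y, - y}) u * (1 - qpow (fibre B (s y)))"
    using fibre_remove_nonzero[OF B y False] fu fu' by (simp add: mult.commute)
  moreover have "prod (?P (B - {y, - y})) ({1..K} - {u}) = prod (?P B) ({1..K} - {u})"
    by (rule prod.cong) (auto simp: u_def fibre_remove_other)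
  ultimately have "prod (?P B) {1..K} =
      prod (?P (B - {y, - y})) {1..K} * (1 - qpow (fibre B (s y)))"
    unfolding prod.remove[OF finite_atLeastAtMost_int u] by (simp only: ac_simps)
  moreover have "fibre (B - {y, - y}) 0 = fibre B 0" using False by (simp add: fibre_remove_other)
  ultimately show ?thesis by (simp only: denom_def mult.assoc)
qed

lemma remove_only_pair:
  assumes "symmetric_set B" "card B = 2" "x \<in> B"
  shows "B - {x, - x} = {}"
  using card_symmetric_set_remove[OF assms(1,3)] assms(1,2) by (simp add: symmetric_set_def)

text \<open>Once \<open>- x\<close> is set apart, only letters of higher label lie above the block
  maximum \<open>x\<close>. The first term is the sign contribution of \<open>x\<close> to the flag
  major index, the second is what the cut-off sum leaves.\<close>

lemma above_remove:
  assumes B: "symmetric_set B" and x: "x \<in> tops B"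
  shows "above B x = (if x < 0 then 1 else 0) + height (B - {x, - x}) (s x)"
proof -
  have xB: "x \<in> B" "- x \<in> B" using assms by (auto simp: tops_def symmetric_set_def)
  have fin: "finite B" using B by (simp add: symmetric_set_def)
  have "{z \<in> B. x < z} = (if x < 0 then {- x} else {}) \<union> {z \<in> B - {x, - x}. s x < s z}"
    using xB tops_less_iff[OF x] by auto
  then show ?thesis
    unfolding above_def height_def using fin by (auto simp: card_Un_disjoint)
qed

text \<open>Common step of both inductions: \<open>c y\<close> is the weight that the new last
  letter contributes in front of a word with head \<open>y\<close>, up to a factor independent of
  \<open>y\<close>.\<close>

lemma sum_words_denom:
  assumes B: "symmetric_set B" "card B = 2 * Suc N" and K: "\<forall>z\<in>B. s z \<le> K"
    and IH: "\<And>y. y \<in> tops B \<Longrightarrow>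
      head_sum f B y * denom K (B - {y, - y}) = qpow (above B y) * numer N"
  shows "(\<Sum>y\<in>tops B. c y * head_sum f B y) * denom K B =
         (\<Sum>y\<in>tops B. c y * (qpow (above B y) * (1 - qpow (fibre B (s y))))) * numer N"
  unfolding sum_distrib_right
proof (rule sum.cong)
  fix y assume y: "y \<in> tops B"
  then have "denom K B = denom K (B - {y, - y}) * (1 - qpow (fibre B (s y)))"
    using denom_remove[OF B(1) _ K] by (simp add: tops_def)
  then have "c y * head_sum f B y * denom K B =
      c y * (1 - qpow (fibre B (s y))) * (head_sum f B y * denom K (B - {y, - y}))"
    by (simp only: ac_simps)
  then show "c y * head_sum f B y * denom K B =
      c y * (qpow (above B y) * (1 - qpow (fibre B (s y)))) * numer N"
    unfolding IH[OF y] by (simp only: ac_simps)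
qed simp

lemma numer_Suc: "numer (Suc N) = (1 - qpow (2 * Suc N)) * numer N"
  by (simp add: numer_def mult.commute)

text \<open>The contribution of \<open>x\<close> depends only on \<open>B\<close> and factors out;
  the remaining heads give the full telescoping sum, which is the next factor of
  \<open>numer\<close>.\<close>

lemma head_sum_word_length:
  assumes "symmetric_set B" "card B = 2 * Suc N" "\<forall>z\<in>B. s z \<le> K" "x \<in> tops B"
  shows "head_sum word_length B x * denom K (B - {x, - x}) = qpow (above B x) * numer N"
  using assms
proof (induction N arbitrary: B x)
  case 0
  then have "x \<in> B" by (simp add: tops_def)
  then have e: "B - {x, - x} = {}" using 0 by (intro remove_only_pair) auto
  then have "letters [x] = B" using \<open>x \<in> B\<close> 0(1) by (auto simp: letters_Cons symmetric_set_def)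
  then show ?case
    unfolding head_sum_def e words_empty by (simp add: denom_def numer_def fibre_def above_def)
next
  case (Suc N)
  let ?B = "B - {x, - x}"
  have xB: "x \<in> B" "- x \<in> B" using Suc.prems by (auto simp: tops_def symmetric_set_def)
  have B: "symmetric_set ?B" "card ?B = 2 * Suc N" "\<forall>z\<in>?B. s z \<le> K"
    using Suc.prems symmetric_set_remove card_symmetric_set_remove[OF Suc.prems(1) xB(1)] by auto
  then have ne: "?B \<noteq> {}" by (metis card.empty mult_is_0 nat.simps(3) zero_neq_numeral)
  have fin: "finite ?B" using B by (simp add: symmetric_set_def)
  have "head_sum word_length B x = (\<Sum>w\<in>words ?B. qpow (above B x) * qpow (word_length w))"
    unfolding head_sum_def
  proof (rule sum.cong)
    fix w assume "w \<in> words ?B"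
    then have "letters (x # w) = B" using xB by (auto simp: words_def letters_Cons)
    then show "qpow (word_length (x # w)) = qpow (above B x) * qpow (word_length w)"
      by (simp add: mult_monom above_def add.commute)
  qed simp
  also have "\<dots> = qpow (above B x) * (\<Sum>y\<in>tops ?B. 1 * head_sum word_length ?B y)"
    unfolding sum_words[OF B(1) ne] head_sum_def by (simp add: sum_distrib_left)
  finally have "head_sum word_length B x * denom K ?B =
      qpow (above B x) * ((\<Sum>y\<in>tops ?B. 1 * head_sum word_length ?B y) * denom K ?B)"
    by (simp only: mult.assoc)
  also have "\<dots> = qpow (above B x) * numer (Suc N)"
    unfolding sum_words_denom[OF B Suc.IH[OF B], simplified]
    by (simp add: sum_tops[OF fin] B(2) numer_Suc del: mult_Suc_right)
  finally show ?case .
qed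

text \<open>The weight of \<open>x\<close> now depends on the head \<open>y\<close> of the rest. The
  sum cut off at the label of \<open>x\<close> and the sign of \<open>x\<close> together restore
  \<open>above B x\<close>.\<close>

lemma head_sum_word_fmaj:
  assumes "symmetric_set B" "card B = 2 * Suc N" "\<forall>z\<in>B. s z \<le> K" "x \<in> tops B"
  shows "head_sum word_fmaj B x * denom K (B - {x, - x}) = qpow (above B x) * numer N"
  using assms
proof (induction N arbitrary: B x)
  case 0
  then have "x \<in> B" by (simp add: tops_def)
  then have e: "B - {x, - x} = {}" using 0 by (intro remove_only_pair) auto
  show ?case
    unfolding head_sum_def above_remove[OF 0(1,4)] e words_empty
    by (simp add: denom_def numer_def fibre_def height_def)
next
  case (Suc N)
  let ?B = "B - {x, - x}"
  define e where "e = (if x < 0 then 1 else 0 :: nat)"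
  \<comment> \<open>The exponent is twice the position of the possible descent and also the number
    of letters of \<open>?B\<close>.\<close>
  define c where "c = (\<lambda>y. if s x < s y then qpow (2 * Suc N) else 1)"
  have xB: "x \<in> B" "- x \<in> B" using Suc.prems by (auto simp: tops_def symmetric_set_def)
  have B: "symmetric_set ?B" "card ?B = 2 * Suc N" "\<forall>z\<in>?B. s z \<le> K"
    using Suc.prems symmetric_set_remove card_symmetric_set_remove[OF Suc.prems(1) xB(1)] by auto
  then have ne: "?B \<noteq> {}" by (metis card.empty mult_is_0 nat.simps(3) zero_neq_numeral)
  have fin: "finite ?B" using B by (simp add: symmetric_set_def)
  have "(\<Sum>w\<in>words (?B - {y, - y}). qpow (word_fmaj (x # y # w))) =
        qpow e * (c y * head_sum word_fmaj ?B y)" if y: "y \<in> tops ?B" for y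
    unfolding head_sum_def sum_distrib_left
  proof (rule sum.cong)
    fix w assume w: "w \<in> words (?B - {y, - y})"
    then have "y # w \<in> words ?B" using Cons_mem_words_iff[OF B(1)] y by simp
    then have "admissible (y # w)" and "letters (y # w) = ?B"
      unfolding words_def by blast+
    then have "2 * length (y # w) = 2 * Suc N" using length_word[of "y # w"] B(2) by metis
    then have len: "length (y # w) = Suc N" by simp
    have "y \<in> B" using y by (simp add: tops_def)
    \<comment> \<open>Labels decide this comparison because \<open>x\<close> is maximal in its block
      within all of \<open>B\<close>, which contains \<open>y\<close>.\<close>
    then have "x < y \<longleftrightarrow> s x < s y" using tops_less_iff Suc.prems(4) by blast
    then have "word_fmaj (x # y # w) = e + ((if s x < s y then 2 * Suc N else 0) + word_fmaj (y # w))"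
      unfolding word_fmaj.simps(2)[of x] len by (simp add: e_def)
    then show "qpow (word_fmaj (x # y # w)) = qpow e * (c y * qpow (word_fmaj (y # w)))"
      by (simp add: c_def mult_monom del: word_fmaj.simps mult_Suc_right)
  qed simp
  then have "head_sum word_fmaj B x = qpow e * (\<Sum>y\<in>tops ?B. c y * head_sum word_fmaj ?B y)"
    unfolding head_sum_def[of _ B] sum_words[OF B(1) ne] by (simp add: sum_distrib_left del: word_fmaj.simps)
  then have "head_sum word_fmaj B x * denom K ?B =
      qpow e * ((\<Sum>y\<in>tops ?B. c y * head_sum word_fmaj ?B y) * denom K ?B)"
    by (simp only: mult.assoc)
  also have "\<dots> = qpow e * ((\<Sum>y\<in>tops ?B. c y * (qpow (above ?B y) * (1 - qpow (fibre ?B (s y))))) * numer N)"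
    by (simp only: sum_words_denom[OF B Suc.IH[OF B]])
  also have "(\<Sum>y\<in>tops ?B. c y * (qpow (above ?B y) * (1 - qpow (fibre ?B (s y))))) =
      qpow (height ?B (s x)) * (1 - qpow (2 * Suc N))"
  proof -
    let ?t = "\<lambda>y. qpow (above ?B y) * (1 - qpow (fibre ?B (s y)))"
    have fint: "finite (tops ?B)" using fin by (simp add: tops_def)
    \<comment> \<open>The weight is 1 minus a correction 1 - q^(2(N+1)) on the letters above
      \<open>x\<close>. The full sum equals that same factor, which comes out and leaves 1 - (1 -
      q^h) = q^h for h = \<open>height ?B (s x)\<close>.\<close>
    have "(\<Sum>y\<in>tops ?B. c y * ?t y) =
        (\<Sum>y\<in>tops ?B. ?t y - (if s x < s y then (1 - qpow (2 * Suc N)) * ?t y else 0))"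
      by (rule sum.cong) (simp_all add: c_def left_diff_distrib del: mult_Suc_right)
    also have "\<dots> = (\<Sum>y\<in>tops ?B. ?t y) -
        (1 - qpow (2 * Suc N)) * (\<Sum>y\<in>{y \<in> tops ?B. s x < s y}. ?t y)"
      unfolding sum_subtractf sum.inter_filter[OF fint, symmetric] sum_distrib_left ..
    also have "\<dots> = (1 - qpow (2 * Suc N)) - (1 - qpow (2 * Suc N)) * (1 - qpow (height ?B (s x)))"
      by (simp only: sum_tops[OF fin] sum_tops_above[OF fin] B(2))
    finally show ?thesis by (simp add: right_diff_distrib mult.commute del: mult_Suc_right)
  qed
  also have "qpow e * (qpow (height ?B (s x)) * (1 - qpow (2 * Suc N)) * numer N) =
      qpow (above B x) * numer (Suc N)"
  proof -
    have "qpow (above B x) = qpow e * qpow (height ?B (s x))"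
      unfolding above_remove[OF Suc.prems(1,4)] e_def by (simp add: mult_monom)
    then show ?thesis by (simp only: numer_Suc mult.assoc)
  qed
  finally show ?case .
qed

lemma head_sum_eq:
  assumes B: "symmetric_set B" and x: "x \<in> tops B"
  shows "head_sum word_length B x = head_sum word_fmaj B x"
proof -
  have "x \<in> B" using x by (simp add: tops_def)
  then have "card B \<noteq> 0" using card_symmetric_set_remove[OF B] by simp
  moreover have "even (card B)" using card_symmetric_set[OF B] by (metis dvd_triv_left)
  ultimately obtain N where N: "card B = 2 * Suc N" by (metis evenE mult_0_right not0_implies_Suc)
  obtain K where K: "\<forall>z\<in>B. s z \<le> K"
    using bdd_above_finite[of "s ` B"] B by (auto simp: bdd_above_def symmetric_set_def)
  show ?thesis
    using head_sum_word_length[OF B N K x] head_sum_word_fmaj[OF B N K x] denom_nonzero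
    by (metis mult_cancel_right)
qed

theorem sum_words_head_eq:
  assumes B: "symmetric_set B" "B \<noteq> {}"
  shows "(\<Sum>w\<in>{w \<in> words B. hd w = x}. qpow (word_length w)) =
         (\<Sum>w\<in>{w \<in> words B. hd w = x}. qpow (word_fmaj w))"
proof (cases "x \<in> tops B")
  case True
  have "(\<Sum>w\<in>{w \<in> words B. hd w = x}. qpow (f w)) = head_sum f B x" for f
    using True by (simp add: words_head_eq[OF B] head_sum_def sum.reindex[unfolded o_def])
  then show ?thesis using head_sum_eq[OF B(1) True] by simp
qed (simp add: words_head_eq[OF B])

end

section \<open>Windows of signed permutations\<close>

definition window :: "(int \<Rightarrow> int) \<Rightarrow> nat \<Rightarrow> int list" where
  "window \<sigma> k = rev (map (\<lambda>p. \<sigma> (int p)) [1..<Suc k])"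

lemma window_0 [simp]: "window \<sigma> 0 = []"
  by (simp add: window_def)

lemma window_Suc [simp]: "window \<sigma> (Suc k) = \<sigma> (int (Suc k)) # window \<sigma> k"
  by (simp add: window_def)

lemma length_window [simp]: "length (window \<sigma> k) = k"
  by (simp add: window_def)

lemma window_eq_iff: "window \<sigma> k = window \<tau> k \<longleftrightarrow> (\<forall>p\<in>{1..k}. \<sigma> (int p) = \<tau> (int p))"
  by (auto simp: window_def)

lemma nth_window: "i < k \<Longrightarrow> window \<sigma> k ! i = \<sigma> (int (k - i))"
  by (induction k arbitrary: i) (auto simp: nth_Cons split: nat.split simp del: of_nat_diff)

lemma pm_interval_0: "pm_interval 0 = {}"
  by (auto simp: pm_interval_def)

lemma pm_interval_Suc:
  "pm_interval (Suc k) = insert (int (Suc k)) (insert (- int (Suc k)) (pm_interval k))"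
  by (auto simp: pm_interval_def)

lemma symmetric_set_pm_interval: "symmetric_set (pm_interval n)"
  by (auto simp: symmetric_set_def pm_interval_def)

lemma card_pm_interval: "card (pm_interval n) = 2 * n"
  by (simp add: pm_interval_def)

lemma letters_window:
  assumes "\<And>p. p \<in> pm_interval k \<Longrightarrow> \<sigma> (- p) = - \<sigma> p"
  shows "letters (window \<sigma> k) = \<sigma> ` pm_interval k"
  using assms
proof (induction k)
  case 0
  then show ?case by (simp add: pm_interval_0)
next
  case (Suc k)
  have "\<sigma> (- int (Suc k)) = - \<sigma> (int (Suc k))"
    by (rule Suc.prems) (simp add: pm_interval_Suc)
  moreover have "letters (window \<sigma> k) = \<sigma> ` pm_interval k"
    by (rule Suc.IH) (simp add: Suc.prems pm_interval_Suc)
  ultimately show ?case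
    unfolding window_Suc letters_Cons pm_interval_Suc image_insert by metis
qed

text \<open>The inversions new at stage k + 1 have right end k + 1. Their left end may be any other
  position up to sign, including \<open>- ?r\<close>, which accounts for a negative entry;
  injectivity turns these positions into letters.\<close>

lemma word_length_window:
  assumes odd: "\<And>p. \<sigma> (- p) = - \<sigma> p" and inj: "inj \<sigma>"
  shows "word_length (window \<sigma> k) = card (B_inversions k \<sigma>)"
proof (induction k)
  case 0
  have "B_inversions 0 \<sigma> = {}" by (auto simp: B_inversions_def)
  then show ?case by simp
next
  case (Suc k)
  let ?r = "int (Suc k)"
  let ?P = "{p \<in> pm_interval (Suc k). \<sigma> ?r < \<sigma> p}"
  have eq: "B_inversions (Suc k) \<sigma> = B_inversions k \<sigma> \<union> (\<lambda>p. (p, ?r)) ` ?P"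
  proof (intro set_eqI)
    fix x :: "int \<times> int"
    obtain p r where x: "x = (p, r)" by fastforce
    consider "r \<le> int k" | "r = ?r" | "r > ?r" by linarith
    then show "x \<in> B_inversions (Suc k) \<sigma> \<longleftrightarrow> x \<in> B_inversions k \<sigma> \<union> (\<lambda>p. (p, ?r)) ` ?P"
      unfolding x
    proof cases
      case 2
      have "p < r" if "p \<in> pm_interval (Suc k)" "\<sigma> r < \<sigma> p"
        using that 2 by (cases "p = r") (auto simp: pm_interval_def)
      then show "(p, r) \<in> B_inversions (Suc k) \<sigma> \<longleftrightarrow>
          (p, r) \<in> B_inversions k \<sigma> \<union> (\<lambda>p. (p, ?r)) ` ?P"
        using 2 by (auto simp: B_inversions_def pm_interval_def)
    qed (auto simp: B_inversions_def)
  qed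
  have "card (B_inversions (Suc k) \<sigma>) = card (B_inversions k \<sigma>) + card ((\<lambda>p. (p, ?r)) ` ?P)"
    unfolding eq
  proof (rule card_Un_disjoint)
    have "finite ?P" by (rule finite_subset[of _ "pm_interval (Suc k)"]) (auto simp: pm_interval_def)
    then show "finite ((\<lambda>p. (p, ?r)) ` ?P)" by (rule finite_imageI)
    show "B_inversions k \<sigma> \<inter> (\<lambda>p. (p, ?r)) ` ?P = {}" by (auto simp: B_inversions_def)
  qed simp
  also have "card ((\<lambda>p. (p, ?r)) ` ?P) = card ?P"
    by (rule card_image) (auto intro: inj_onI)
  also have "card ?P = card (\<sigma> ` ?P)"
    by (rule card_image[symmetric]) (rule inj_on_subset[OF inj subset_UNIV])
  also have "\<sigma> ` ?P = {z \<in> letters (window \<sigma> (Suc k)). \<sigma> ?r < z}"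
    unfolding letters_window[of "Suc k" \<sigma>, OF odd] by auto
  finally show ?case using Suc.IH by simp
qed

lemma word_fmaj_window: "word_fmaj (window \<sigma> k) = fmaj k \<sigma>"
proof (induction k)
  case 0
  show ?case by (simp add: fmaj_def maj_A_def neg_count_def)
next
  case (Suc k)
  let ?D = "\<lambda>k. {i \<in> {1..<k}. \<sigma> (int i) > \<sigma> (int i + 1)}"
  have "?D (Suc k) = (if k \<noteq> 0 \<and> \<sigma> (int k + 1) < \<sigma> (int k) then insert k (?D k) else ?D k)"
    by (auto simp: less_Suc_eq)
  then have maj: "maj_A (Suc k) \<sigma> =
      maj_A k \<sigma> + (if k \<noteq> 0 \<and> \<sigma> (int k + 1) < \<sigma> (int k) then k else 0)"
    by (simp add: maj_A_def)
  have "{i \<in> {1..Suc k}. \<sigma> (int i) < 0} = (if \<sigma> (int (Suc k)) < 0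
      then insert (Suc k) {i \<in> {1..k}. \<sigma> (int i) < 0} else {i \<in> {1..k}. \<sigma> (int i) < 0})"
    by (auto simp: le_Suc_eq)
  then have neg: "neg_count (Suc k) \<sigma> = neg_count k \<sigma> + (if \<sigma> (int (Suc k)) < 0 then 1 else 0)"
    by (simp add: neg_count_def)
  have "window \<sigma> k \<noteq> [] \<and> \<sigma> (int (Suc k)) < hd (window \<sigma> k) \<longleftrightarrow>
      k \<noteq> 0 \<and> \<sigma> (int k + 1) < \<sigma> (int k)"
    by (cases k) (simp_all add: add.commute)
  then show ?case using Suc.IH maj neg by (simp add: fmaj_def)
qed

lemma word_is_window:
  assumes "letters w = pm_interval n" "length w = n"
  obtains \<sigma> where "\<sigma> \<in> hyperoctahedral n" "window \<sigma> n = w"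
proof
  \<comment> \<open>The head of the list is position \<open>n\<close>, so position \<open>p\<close>
    has index \<open>n - p\<close>; negative positions are forced by oddness.\<close>
  define \<sigma> where "\<sigma> p = (if p \<in> pm_interval n then
      if 0 < p then w ! (n - nat p) else - w ! (n - nat (- p)) else p)" for p
  have odd: "\<sigma> (- p) = - \<sigma> p" if "p \<in> pm_interval n" for p
    using that by (auto simp: \<sigma>_def pm_interval_def)
  show win: "window \<sigma> n = w"
  proof (rule nth_equalityI)
    fix i assume "i < length (window \<sigma> n)"
    then show "window \<sigma> n ! i = w ! i"
      by (simp add: nth_window \<sigma>_def pm_interval_def del: of_nat_diff)
  qed (simp add: assms)
  have fin: "finite (pm_interval n)" by (simp add: pm_interval_def)
  have surj: "\<sigma> ` pm_interval n = pm_interval n"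
    using letters_window[of n \<sigma>, OF odd] win assms(1) by simp
  then have "inj_on \<sigma> (pm_interval n)" using fin by (simp add: eq_card_imp_inj_on)
  then have "\<sigma> permutes pm_interval n"
    using surj by (intro bij_imp_permutes) (auto simp: bij_betw_def \<sigma>_def)
  then show "\<sigma> \<in> hyperoctahedral n" using odd by (simp add: hyperoctahedral_def)
qed

section \<open>Descents of the inverse and monotonicity on blocks\<close>

lemma int_increasing_chain:
  fixes \<tau> :: "int \<Rightarrow> int"
  assumes "\<And>k. \<lbrakk>u \<le> k; k < v\<rbrakk> \<Longrightarrow> \<tau> k < \<tau> (k + 1)" "u < v"
  shows "\<tau> u < \<tau> v"
proof -
  have "\<tau> u < \<tau> (u + 1 + int j)" if "u + int j < v" for j
    using that
  proof (induction j)
    case 0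
    then show ?case using assms by simp
  next
    case (Suc j)
    then have "\<tau> u < \<tau> (u + 1 + int j)" by simp
    also have "\<dots> < \<tau> (u + 1 + int j + 1)" using Suc.prems by (intro assms) auto
    finally show ?case by (simp add: algebra_simps)
  qed
  from this[of "nat (v - u - 1)"] show ?thesis using assms(2) by simp
qed

text \<open>An element \<open>m\<close> of \<open>M\<close> is a cut between \<open>m\<close> and
  \<open>m + 1\<close>. If 0 is not in \<open>M\<close>, then 1 and -1 both lie in block 0; this is
  how the sign-changing generator enters the block condition.\<close>

definition block :: "nat set \<Rightarrow> int \<Rightarrow> int" where
  "block M z = (if 0 \<le> z then int (card {m \<in> M. int m < z}) else - int (card {m \<in> M. int m < - z}))"

lemma block_succ:
  assumes "finite M"
  shows "block M (int k) = block M (int k + 1) \<longleftrightarrow> k \<notin> M"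
proof -
  have "{m \<in> M. int m < int k + 1} =
      (if k \<in> M then insert k {m \<in> M. int m < int k} else {m \<in> M. int m < int k})"
    by (auto simp: nat_less_le)
  then show ?thesis using assms by (simp add: block_def)
qed

lemma signed_blocks_block:
  assumes "finite M"
  shows "signed_blocks (block M)"
proof
  show "mono (block M)"
  proof
    fix x y :: int assume "x \<le> y"
    have "card {m \<in> M. int m < a} \<le> card {m \<in> M. int m < b}" if "a \<le> b" for a b
      using assms that by (intro card_mono) auto
    from this[of x y] this[of "- y" "- x"] \<open>x \<le> y\<close> show "block M x \<le> block M y"
      by (auto simp: block_def)
  qed
  have "{m \<in> M. int m < 0} = {}" by auto
  then show "block M (- z) = - block M z" for z
    by (cases z "0::int" rule: linorder_cases) (simp_all add: block_def)
qed

context signed_blocks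
begin

lemma admissible_window_iff:
  assumes odd_\<sigma>: "\<And>p. \<sigma> (- p) = - \<sigma> p" and inj: "inj \<sigma>"
  shows "admissible (window \<sigma> k) \<longleftrightarrow>
    (\<forall>r\<in>{1..k}. \<forall>p\<in>pm_interval r. s (\<sigma> p) = s (\<sigma> (int r)) \<longrightarrow> \<sigma> p \<le> \<sigma> (int r))"
proof (induction k)
  case (Suc k)
  have letters: "letters (window \<sigma> k) = \<sigma> ` pm_interval k" for k
    by (rule letters_window) (rule odd_\<sigma>)
  have "\<sigma> 0 = 0" using odd_\<sigma>[of 0] by simp
  then have "\<sigma> (int (Suc k)) \<noteq> 0" using injD[OF inj, of "int (Suc k)" 0] by auto
  moreover have "\<sigma> (int (Suc k)) \<notin> letters (window \<sigma> k)"
    unfolding letters inj_image_mem_iff[OF inj] by (simp add: pm_interval_def)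
  moreover have "\<sigma> (int (Suc k)) \<in> tops (letters (window \<sigma> (Suc k))) \<longleftrightarrow>
      (\<forall>p\<in>pm_interval (Suc k). s (\<sigma> p) = s (\<sigma> (int (Suc k))) \<longrightarrow> \<sigma> p \<le> \<sigma> (int (Suc k)))"
    unfolding tops_def letters by (auto simp: pm_interval_Suc)
  ultimately have "admissible (window \<sigma> (Suc k)) \<longleftrightarrow> admissible (window \<sigma> k) \<and>
      (\<forall>p\<in>pm_interval (Suc k). s (\<sigma> p) = s (\<sigma> (int (Suc k))) \<longrightarrow> \<sigma> p \<le> \<sigma> (int (Suc k)))"
    unfolding window_Suc admissible.simps by blast
  moreover have "{1..Suc k} = insert (Suc k) {1..k}" by auto
  ultimately show ?case by (simp only: Suc.IH ball_simps conj_commute)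
qed simp

text \<open>Two letters of a block first meet in the prefix ending at the larger absolute position,
  so maximality in every prefix decides the relative position of any two letters of a block.\<close>

lemma admissible_window_iff_inv:
  assumes \<sigma>: "\<sigma> \<in> hyperoctahedral n"
  shows "admissible (window \<sigma> n) \<longleftrightarrow>
    (\<forall>u\<in>pm_interval n. \<forall>v\<in>pm_interval n. u < v \<longrightarrow> s u = s v \<longrightarrow> inv \<sigma> u < inv \<sigma> v)"
proof -
  note perm = hyperoctahedral_permutes[OF \<sigma>] and odd_\<sigma> = hyperoctahedral_odd[OF \<sigma>]
  note inv = permutes_inverses[OF perm]
  note mem = permutes_in_image[OF perm] permutes_in_image[OF permutes_inv[OF perm]]
  have "(\<forall>r\<in>{1..n}. \<forall>p\<in>pm_interval r. s (\<sigma> p) = s (\<sigma> (int r)) \<longrightarrow> \<sigma> p \<le> \<sigma> (int r)) \<longleftrightarrow>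
    (\<forall>u\<in>pm_interval n. \<forall>v\<in>pm_interval n. u < v \<longrightarrow> s u = s v \<longrightarrow> inv \<sigma> u < inv \<sigma> v)"
    (is "?L \<longleftrightarrow> ?R")
  proof
    assume L: ?L
    show ?R
    proof (intro ballI impI)
      fix u v assume uv: "u \<in> pm_interval n" "v \<in> pm_interval n" "u < v" "s u = s v"
      define a where "a = inv \<sigma> u"
      define b where "b = inv \<sigma> v"
      have ab: "\<sigma> a = u" "\<sigma> b = v" "a \<in> pm_interval n" "b \<in> pm_interval n"
        using uv inv mem by (simp_all add: a_def b_def)
      show "inv \<sigma> u < inv \<sigma> v"
      proof (rule ccontr)
        assume "\<not> inv \<sigma> u < inv \<sigma> v"
        moreover have "a \<noteq> b" using ab uv by auto
        ultimately have "b < a" by (simp add: a_def b_def)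
        then consider "\<bar>b\<bar> \<le> a" | "\<bar>a\<bar> \<le> - b" by linarith
        then show False
        proof cases
          case 1
          then have "nat a \<in> {1..n}" "b \<in> pm_interval (nat a)" "int (nat a) = a"
            using ab \<open>b < a\<close> by (auto simp: pm_interval_def)
          then have "\<sigma> b \<le> \<sigma> a" using L ab uv by metis
          then show False using ab uv by simp
        next
          \<comment> \<open>Here the larger absolute position is the negative one, which ends no
            prefix. The mirror pair \<open>- a\<close>, \<open>- b\<close> is tested instead; its
            labels agree because \<open>s\<close> is odd.\<close>
          case 2
          then have "nat (- b) \<in> {1..n}" "- a \<in> pm_interval (nat (- b))" "int (nat (- b)) = - b"
            using ab \<open>b < a\<close> by (auto simp: pm_interval_def)
          then have "\<sigma> (- a) \<le> \<sigma> (- b)" using L ab uv odd odd_\<sigma> by metis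
          then show False using ab uv odd_\<sigma> by simp
        qed
      qed
    qed
  next
    assume R: ?R
    show ?L
    proof (intro ballI impI)
      fix r p assume r: "r \<in> {1..n}" "p \<in> pm_interval r" "s (\<sigma> p) = s (\<sigma> (int r))"
      then have pr: "p \<in> pm_interval n" "int r \<in> pm_interval n" "p \<le> int r"
        by (auto simp: pm_interval_def)
      show "\<sigma> p \<le> \<sigma> (int r)"
      proof (rule ccontr)
        assume "\<not> \<sigma> p \<le> \<sigma> (int r)"
        then have "inv \<sigma> (\<sigma> (int r)) < inv \<sigma> (\<sigma> p)" using R mem r pr by auto
        then show False using inv pr by simp
      qed
    qed
  qed
  then show ?thesis
    unfolding admissible_window_iff[OF odd_\<sigma> permutes_inj[OF perm]] .
qed

end

text \<open>Labels between \<open>u\<close> and \<open>v\<close> are squeezed to a constant, so a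
  comparison within a block is a chain of unit steps. In block 0 this chain passes through 0, which
  is not a letter.\<close>

lemma B_Des_subset_iff:
  assumes \<tau>: "\<tau> \<in> hyperoctahedral n" and M: "finite M"
  shows "B_Des n \<tau> \<subseteq> M \<longleftrightarrow>
    (\<forall>u\<in>pm_interval n. \<forall>v\<in>pm_interval n. u < v \<longrightarrow> block M u = block M v \<longrightarrow> \<tau> u < \<tau> v)"
    (is "_ \<longleftrightarrow> ?R")
proof -
  interpret signed_blocks "block M" by (rule signed_blocks_block[OF M])
  note odd_\<tau> = hyperoctahedral_odd[OF \<tau>] and zero = hyperoctahedral_zero[OF \<tau>]
  have "B_Des n \<tau> \<subseteq> M \<longleftrightarrow> (\<forall>i<n. i \<notin> M \<longrightarrow> \<tau> (int i) < \<tau> (int i + 1))"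
  proof -
    have "\<tau> (int i + 1) < \<tau> (int i) \<longleftrightarrow> \<not> \<tau> (int i) < \<tau> (int i + 1)" for i
      using hyperoctahedral_not_less_iff[OF \<tau>, of "int i" "int i + 1"] by simp
    then show ?thesis by (auto simp: B_Des_iff[OF \<tau>])
  qed
  also have "\<dots> \<longleftrightarrow> ?R"
  proof
    assume L: "\<forall>i<n. i \<notin> M \<longrightarrow> \<tau> (int i) < \<tau> (int i + 1)"
    have step: "\<tau> k < \<tau> (k + 1)"
      if k: "- int n \<le> k" "k < int n" "block M k = block M (k + 1)" for k
    proof (cases "0 \<le> k")
      case True
      then have "int (nat k) = k" "nat k < n" using k by auto
      moreover then have "nat k \<notin> M" using block_succ[OF M, of "nat k"] k by simp
      ultimately show ?thesis using L by metis
    next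
      case False
      \<comment> \<open>The step from \<open>k\<close> to \<open>k + 1\<close> below 0 is the mirror
        image of the step from \<open>i\<close> to \<open>i + 1\<close>.\<close>
      define i where "i = nat (- (k + 1))"
      have i: "int i = - (k + 1)" "int i + 1 = - k" "i < n" using False k by (auto simp: i_def)
      have "block M (- (k + 1)) = block M (- k)" unfolding odd using k(3) by simp
      then have "block M (int i) = block M (int i + 1)" by (metis i(1,2))
      then have "\<tau> (int i) < \<tau> (int i + 1)" using L i(3) block_succ[OF M, of i] by blast
      then have "\<tau> (- (k + 1)) < \<tau> (- k)" by (metis i(1,2))
      then show ?thesis unfolding odd_\<tau> by simp
    qed
    show ?R
    proof (intro ballI impI)
      fix u v assume uv: "u \<in> pm_interval n" "v \<in> pm_interval n" "u < v" "block M u = block M v"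
      show "\<tau> u < \<tau> v"
      proof (rule int_increasing_chain[OF _ uv(3)])
        fix k assume k: "u \<le> k" "k < v"
        then have "block M u \<le> block M k" "block M k \<le> block M (k + 1)" "block M (k + 1) \<le> block M v"
          using mono by (simp_all add: monoD)
        then show "\<tau> k < \<tau> (k + 1)" using uv k by (intro step) (auto simp: pm_interval_def)
      qed
    qed
  next
    assume R: ?R
    show "\<forall>i<n. i \<notin> M \<longrightarrow> \<tau> (int i) < \<tau> (int i + 1)"
    proof (intro allI impI)
      fix i assume i: "i < n" "i \<notin> M"
      then have b: "block M (int i) = block M (int i + 1)" using block_succ[OF M] by simp
      show "\<tau> (int i) < \<tau> (int i + 1)"
      proof (cases "i = 0")
        \<comment> \<open>Since 0 is no letter, the step from 0 to 1 is read off from the pair -1, 1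
          in block 0: by oddness \<tau>(-1) < \<tau>(1) means \<tau>(1) > 0.\<close>
        case True
        then have "block M 1 = 0" using b odd[of 0] by simp
        then have "block M (- 1) = block M 1" using odd[of 1] by simp
        then have "\<tau> (- 1) < \<tau> 1" using R i by (simp add: pm_interval_def)
        then show ?thesis using True odd_\<tau>[of 1] zero by simp
      next
        case False
        then show ?thesis using R i b by (simp add: pm_interval_def)
      qed
    qed
  qed
  finally show ?thesis .
qed

section \<open>From signed permutations to admissible words\<close>

lemma bij_betw_window:
  assumes "finite M"
  shows "bij_betw (\<lambda>\<sigma>. window \<sigma> n) {\<sigma> \<in> hyperoctahedral n. B_Des n (inv \<sigma>) \<subseteq> M}
    (signed_blocks.words (block M) (pm_interval n))"
proof -
  interpret signed_blocks "block M" by (rule signed_blocks_block[OF assms])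
  have adm: "admissible (window \<sigma> n) \<longleftrightarrow> B_Des n (inv \<sigma>) \<subseteq> M" if "\<sigma> \<in> hyperoctahedral n" for \<sigma>
    unfolding admissible_window_iff_inv[OF that]
      B_Des_subset_iff[OF hyperoctahedral_inv[OF that] assms] ..
  have lets: "letters (window \<sigma> n) = pm_interval n" if "\<sigma> \<in> hyperoctahedral n" for \<sigma>
    using letters_window[of n \<sigma>] hyperoctahedral_odd[OF that]
      permutes_image[OF hyperoctahedral_permutes[OF that]] by simp
  show ?thesis
  proof (rule bij_betw_imageI)
    show "inj_on (\<lambda>\<sigma>. window \<sigma> n) {\<sigma> \<in> hyperoctahedral n. B_Des n (inv \<sigma>) \<subseteq> M}"
    proof (rule inj_onI)
      fix \<sigma> \<tau> assume "\<sigma> \<in> {\<sigma> \<in> hyperoctahedral n. B_Des n (inv \<sigma>) \<subseteq> M}"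
        and "\<tau> \<in> {\<sigma> \<in> hyperoctahedral n. B_Des n (inv \<sigma>) \<subseteq> M}"
        and eq: "window \<sigma> n = window \<tau> n"
      then have \<sigma>: "\<sigma> \<in> hyperoctahedral n" and \<tau>: "\<tau> \<in> hyperoctahedral n" by auto
      have pos: "\<sigma> p = \<tau> p" if "1 \<le> p" "p \<le> int n" for p
      proof -
        have "nat p \<in> {1..n}" "int (nat p) = p" using that by auto
        then show ?thesis using eq unfolding window_eq_iff by metis
      qed
      show "\<sigma> = \<tau>"
      proof
        fix p
        consider "p \<notin> pm_interval n" | "1 \<le> p" "p \<le> int n" | "1 \<le> - p" "- p \<le> int n"
          by (force simp: pm_interval_def)
        then show "\<sigma> p = \<tau> p"
        proof cases
          case 1
          then show ?thesis
            using permutes_not_in[OF hyperoctahedral_permutes[OF \<sigma>]]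
              permutes_not_in[OF hyperoctahedral_permutes[OF \<tau>]] by simp
        next
          case 3
          then show ?thesis
            using pos[of "- p"] hyperoctahedral_odd[OF \<sigma>, of p] hyperoctahedral_odd[OF \<tau>, of p]
            by simp
        qed (rule pos)
      qed
    qed
    show "(\<lambda>\<sigma>. window \<sigma> n) ` {\<sigma> \<in> hyperoctahedral n. B_Des n (inv \<sigma>) \<subseteq> M} =
        words (pm_interval n)"
    proof (intro equalityI subsetI)
      fix w assume w: "w \<in> words (pm_interval n)"
      then have "letters w = pm_interval n" "length w = n"
        using length_word[of w] card_pm_interval[of n] by (auto simp: words_def)
      then obtain \<sigma> where \<sigma>: "\<sigma> \<in> hyperoctahedral n" "window \<sigma> n = w"
        by (rule word_is_window)
      then have "B_Des n (inv \<sigma>) \<subseteq> M" using adm w by (auto simp: words_def)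
      then show "w \<in> (\<lambda>\<sigma>. window \<sigma> n) ` {\<sigma> \<in> hyperoctahedral n. B_Des n (inv \<sigma>) \<subseteq> M}"
        using \<sigma> by blast
    qed (auto simp: words_def adm lets)
  qed
qed

theorem theorem3p2:
  fixes n :: nat and M :: "nat set" and i :: int
  assumes "n \<ge> 1" and "M \<subseteq> {0..n - 1}" and "i \<in> pm_interval n"
  shows "(\<Sum>\<sigma>\<in>{\<sigma> \<in> hyperoctahedral n. B_Des n (inv \<sigma>) \<subseteq> M \<and> \<sigma> (int n) = i}.
            monom (1::int) (B_length n \<sigma>)) =
         (\<Sum>\<sigma>\<in>{\<sigma> \<in> hyperoctahedral n. B_Des n (inv \<sigma>) \<subseteq> M \<and> \<sigma> (int n) = i}.
            monom (1::int) (fmaj n \<sigma>))"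
proof -
  have M: "finite M" using assms(2) by (rule finite_subset) simp
  interpret signed_blocks "block M" by (rule signed_blocks_block[OF M])
  let ?S = "{\<sigma> \<in> hyperoctahedral n. B_Des n (inv \<sigma>) \<subseteq> M \<and> \<sigma> (int n) = i}"
  let ?W = "{w \<in> words (pm_interval n). hd w = i}"
  \<comment> \<open>The head of an empty list is unspecified; \<open>n \<ge> 1\<close> makes the
    head the last entry of the window.\<close>
  have hd: "hd (window \<sigma> n) = \<sigma> (int n)" for \<sigma> using assms(1) by (cases n) auto
  have bij: "bij_betw (\<lambda>\<sigma>. window \<sigma> n) ?S ?W"
  proof (rule bij_betw_subset[OF bij_betw_window[OF M, of n]])
    show "(\<lambda>\<sigma>. window \<sigma> n) ` ?S = ?W"
      unfolding bij_betw_imp_surj_on[OF bij_betw_window[OF M, of n], symmetric]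
      using hd by auto
  qed auto
  have sum: "(\<Sum>w\<in>?W. qpow (f w)) = (\<Sum>\<sigma>\<in>?S. qpow (f (window \<sigma> n)))" for f
    by (rule sum.reindex_bij_betw[OF bij, symmetric])
  have len: "word_length (window \<sigma> n) = B_length n \<sigma>" if "\<sigma> \<in> hyperoctahedral n" for \<sigma>
    unfolding B_length_eq_card_inversions[OF that]
    by (intro word_length_window hyperoctahedral_odd[OF that]
        permutes_inj[OF hyperoctahedral_permutes[OF that]])
  have "(\<Sum>\<sigma>\<in>?S. qpow (B_length n \<sigma>)) = (\<Sum>w\<in>?W. qpow (word_length w))"
    unfolding sum by (rule sum.cong) (simp_all add: len)
  also have "\<dots> = (\<Sum>w\<in>?W. qpow (word_fmaj w))"
    by (rule sum_words_head_eq[OF symmetric_set_pm_interval]) (use assms(3) in blast)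
  also have "\<dots> = (\<Sum>\<sigma>\<in>?S. qpow (fmaj n \<sigma>))"
    unfolding sum word_fmaj_window ..
  finally show ?thesis .
qed

end
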